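(* Let $\ell\in\{2,3,4,\ldots\}$, let $a_1,a_2,\ldots,a_{2\ell}$ be fixed real numbers with $-1=a_{2\ell}<a_{2\ell-1}<\ldots<a_{2}<a_{1}=1$, let $$E:=\bigcup_{j=1}^{\ell}[a_{2j},a_{2j-1}],$$ and define $\Lambda:=\{z\in\mathbb{C}:|z|=1,\ \operatorname{Re} z\in E\}$, i.e., the set $E$ is the projection of $\Lambda$ onto the real axis. Then there exists a constant $B$ depending only on $\Lambda$ such that for each $n\in\mathbb{N}$ $$L_{n}(\Lambda)\leq B\,(\operatorname{cap}\Lambda)^{n}.$$
   Context: Here $\mathbb{N}=\{1,2,3,\ldots\}$. For a compact infinite set $S\subset\mathbb{C}$ and $n\in\mathbb{N}$, the minimum deviation of degree $n$ on $S$ is $$L_n(S):=\min_{c_0,\ldots,c_{n-1}\in\mathbb{C}}\ \max_{z\in S}\Bigl|z^n+\sum_{k=0}^{n-1}c_k z^k\Bigr|.$$ The logarithmic capacity of $S$ is $\operatorname{cap} S:=\lim_{n\to\infty}\sqrt[n]{L_n(S)}$ (the limit exists by Fekete's theorem). *)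

theory Defs
  imports "HOL-Analysis.Analysis"
begin

(* Meant for compact infinite S and n >= 1. For such S the maximum over S is attained by
   compactness, and the minimum over the coefficients is attained as a best approximation from
   the finite-dimensional space of polynomials of degree < n in the sup norm on S; so SUP and
   INF (of reals) are the maximum and the minimum. Only c 0, ..., c (n - 1) matter. *)

definition min_deviation :: "nat \<Rightarrow> complex set \<Rightarrow> real" where
  "min_deviation n S =
     (INF c :: nat \<Rightarrow> complex. SUP z\<in>S. norm (z ^ n + (\<Sum>k<n. c k * z ^ k)))"

(* The limit exists for compact infinite S by Fekete's theorem; the value at n = 0 is irrelevant. *)

definition log_capacity :: "complex set \<Rightarrow> real" where
  "log_capacity S = lim (\<lambda>n. root n (min_deviation n S))"

end

theory Submission
  imports Defs "HOL-Computational_Algebra.Fundamental_Theorem_Algebra"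
begin

text \<open>
  Idea. For a monic real \<open>T\<close> of degree \<open>n\<close> the polynomial \<open>(2 z) ^ n * T (Re z)\<close> is monic of degree
  \<open>2 n\<close> on the unit circle, so it suffices to bound from below every monic \<open>Q\<close> of degree \<open>D\<close> on
  \<open>\<Lambda>\<close> in terms of a suitable \<open>T\<close>. Take \<open>T\<close> almost optimal on \<open>E\<close>, taking the values \<open>d\<close> and \<open>-d\<close>
  alternately at \<open>n + 1\<close> points of \<open>E\<close>. If \<open>\<bar>y\<bar> < d\<close>, then \<open>T = y\<close> has \<open>n\<close> real roots interlacing
  these points, so each gap of \<open>E\<close> contains at most one of them. Symmetrising \<open>Q\<close> under \<open>z \<mapsto> 1 / z\<close>
  gives a monic polynomial \<open>R\<close> in \<open>x = Re z\<close>. The product of \<open>R\<close> over the roots of \<open>T = y\<close> is, up to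
  sign, monic in \<open>y\<close>, hence not small for all such \<open>y\<close>; on the other hand all but boundedly many
  factors are at most the supremum of \<open>\<bar>R\<bar>\<close> on \<open>E\<close>, and the exceptional ones exceed it at most by a
  factor \<open>M ^ (D + 1)\<close> with \<open>M\<close> independent of \<open>n\<close>. This bounds \<open>min_deviation D\<close> below by a power of
  \<open>min_deviation (2 n)\<close> with a constant independent of \<open>n\<close> and \<open>D\<close>. Letting \<open>D\<close> tend to infinity
  yields both the existence of the capacity and the bound.
\<close>

subsection \<open>Lagrange interpolation\<close>

text \<open>For \<open>x\<close> in a finite \<open>X\<close> this is the derivative at
  \<open>x\<close> of the nodal polynomial of \<open>X\<close>; its reciprocal is the barycentric
  weight of \<open>x\<close>.\<close>

definition node_prod :: "'a::field set \<Rightarrow> 'a \<Rightarrow> 'a" where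
  "node_prod X x = (\<Prod>y\<in>X - {x}. x - y)"

lemma node_prod_nonzero: "finite X \<Longrightarrow> node_prod X x \<noteq> 0"
  by (simp add: node_prod_def)

lemma degree_prod_linear: "finite A \<Longrightarrow> degree (\<Prod>y\<in>A. [:- f y, 1:] :: 'a::field poly) = card A"
  by (subst degree_prod_sum_eq) auto

lemma lead_coeff_prod_linear:
  "finite A \<Longrightarrow> coeff (\<Prod>y\<in>A. [:- f y, 1:] :: 'a::field poly) (card A) = 1"
  using lead_coeff_prod[of "\<lambda>y. [:- f y, 1:] :: 'a poly" A] degree_prod_linear[of A f] by simp

definition interp :: "'a::field set \<Rightarrow> ('a \<Rightarrow> 'a) \<Rightarrow> 'a poly" where
  "interp X f = (\<Sum>x\<in>X. smult (f x / node_prod X x) (\<Prod>y\<in>X - {x}. [:- y, 1:]))"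

lemma poly_interp_eq:
  "poly (interp X f) z = (\<Sum>x\<in>X. f x / node_prod X x * (\<Prod>y\<in>X - {x}. z - y))"
  by (simp add: interp_def poly_sum poly_prod)

lemma poly_interp:
  assumes "finite X" "z \<in> X"
  shows "poly (interp X f) z = f z"
proof -
  have "poly (interp X f) z =
      (\<Sum>x\<in>X. if x = z then f z / node_prod X z * (\<Prod>y\<in>X - {z}. z - y) else 0)"
    unfolding poly_interp_eq using assms by (intro sum.cong) auto
  also have "\<dots> = f z"
    using assms node_prod_nonzero[of X z] by (simp add: node_prod_def)
  finally show ?thesis .
qed

lemma degree_interp:
  assumes "card X = Suc n"
  shows "degree (interp X f) \<le> n"
proof -
  have fin: "finite X" using assms card.infinite by fastforce
  show ?thesis unfolding interp_def
  proof (rule degree_sum_le[OF fin])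
    fix x assume "x \<in> X"
    then show "degree (smult (f x / node_prod X x) (\<Prod>y\<in>X - {x}. [:- y, 1:])) \<le> n"
      using degree_prod_linear[of "X - {x}" "\<lambda>y. y"] fin assms
      by (intro order.trans[OF degree_smult_le]) simp
  qed
qed

lemma coeff_interp:
  assumes "card X = Suc n"
  shows "coeff (interp X f) n = (\<Sum>x\<in>X. f x / node_prod X x)"
proof -
  have fin: "finite X" using assms card.infinite by fastforce
  have "coeff (\<Prod>y\<in>X - {x}. [:- y, 1:]) n = 1" if "x \<in> X" for x
    using lead_coeff_prod_linear[of "X - {x}" "\<lambda>y. y"] fin that assms by simp
  then show ?thesis by (simp add: interp_def coeff_sum)
qed

lemma interp_poly:
  assumes "card X = Suc n" "degree p \<le> n"
  shows "interp X (poly p) = p"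
proof (rule poly_eqI_degree)
  have "finite X" using assms card.infinite by fastforce
  then show "poly (interp X (poly p)) x = poly p x" if "x \<in> X" for x
    using that by (rule poly_interp)
  show "degree (interp X (poly p)) < card X" "degree p < card X"
    using degree_interp[OF assms(1), of "poly p"] assms by simp_all
qed

text \<open>The right-hand side is the divided difference of order \<open>n\<close>. It ties the top
  coefficient to values at the nodes, and is the source both of the coefficient bounds and of the
  optimality argument for alternating polynomials.\<close>

lemma coeff_eq_sum_node_prod:
  assumes "card X = Suc n" "degree p \<le> n"
  shows "coeff p n = (\<Sum>x\<in>X. poly p x / node_prod X x)"
  using coeff_interp[OF assms(1), of "poly p"] interp_poly[OF assms] by simp

section \<open>Exponential growth bounds for polynomials on an interval\<close>

lemma power_self_le_fact_exp: "real n ^ n \<le> fact n * exp 1 ^ n"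
proof -
  have "real n ^ n / fact n \<le> exp (real n)"
  proof -
    have s: "(\<lambda>k. real n ^ k /\<^sub>R fact k) sums exp (real n)" by (rule exp_converges)
    have "(\<Sum>k\<in>{n}. real n ^ k /\<^sub>R fact k) \<le> (\<Sum>k. real n ^ k /\<^sub>R fact k)"
      using s by (intro sum_le_suminf) (auto simp: sums_iff)
    then show ?thesis using s by (simp add: sums_iff field_simps)
  qed
  then show ?thesis by (simp add: field_simps exp_of_nat_mult[symmetric])
qed

lemma prod_abs_diff_nat:
  assumes "j \<le> n"
  shows "(\<Prod>i\<in>{..n} - {j}. \<bar>real j - real i\<bar>) = fact j * fact (n - j)"
proof -
  have split: "{..n} - {j} = {..<j} \<union> {Suc j..n}" using assms by auto
  have "(\<Prod>i\<in>{..n} - {j}. \<bar>real j - real i\<bar>)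
      = (\<Prod>i<j. \<bar>real j - real i\<bar>) * (\<Prod>i=Suc j..n. \<bar>real j - real i\<bar>)"
    unfolding split by (rule prod.union_disjoint) auto
  also have "(\<Prod>i<j. \<bar>real j - real i\<bar>) = (\<Prod>i=1..j. real i)"
    by (intro prod.reindex_bij_witness[of _ "\<lambda>i. j - i" "\<lambda>i. j - i"]) auto
  also have "\<dots> = fact j" by (simp add: fact_prod)
  also have "(\<Prod>i=Suc j..n. \<bar>real j - real i\<bar>) = (\<Prod>i=1..n-j. real i)"
    by (intro prod.reindex_bij_witness[of _ "\<lambda>i. j + i" "\<lambda>i. i - j"]) auto
  also have "\<dots> = fact (n - j)" by (simp add: fact_prod)
  finally show ?thesis .
qed

text \<open>With step \<open>h\<close> the weight at node \<open>j\<close> is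
  \<open>h ^ n * fact j * fact (n - j)\<close> in modulus. The factorials are at least
  \<open>fact n / 2 ^ n\<close>, since a binomial coefficient is at most \<open>2 ^ n\<close>, and
  \<open>fact n\<close> is at least \<open>(n / exp 1) ^ n\<close>; finally
  \<open>n * h = v - u\<close>.\<close>

lemma ex_equispaced_nodes:
  fixes u v :: real
  assumes "u < v"
  obtains X where "X \<subseteq> {u..v}" "card X = Suc n"
    "\<And>x. x \<in> X \<Longrightarrow> 1 / \<bar>node_prod X x\<bar> \<le> (2 * exp 1 / (v - u)) ^ n"
proof -
  \<comment> \<open>For \<open>n = 0\<close> only the node \<open>u\<close> occurs; the value 1 just
    keeps the step positive.\<close>
  define h where "h = (if n = 0 then 1 else (v - u) / n)"
  define g where "g i = u + real i * h" for i
  have h: "h > 0" using assms by (simp add: h_def)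
  have inj: "inj_on g A" for A using h by (auto simp: inj_on_def g_def)
  have le: "g i \<le> v" if "i \<le> n" for i
  proof (cases "n = 0")
    case False
    have "real i * h \<le> real n * h" using that h by (intro mult_right_mono) auto
    also have "\<dots> = v - u" using False by (simp add: h_def)
    finally show ?thesis by (simp add: g_def)
  qed (use that assms in \<open>auto simp: g_def\<close>)
  have ge: "u \<le> g i" for i using h by (simp add: g_def)
  have bound: "1 / \<bar>node_prod (g ` {..n}) (g j)\<bar> \<le> (2 * exp 1 / (v - u)) ^ n" if "j \<le> n" for j
  proof (cases "n = 0")
    case False
    have "g ` {..n} - {g j} = g ` ({..n} - {j})"
      using inj[of UNIV] by (simp add: image_set_diff)
    then have "\<bar>node_prod (g ` {..n}) (g j)\<bar> = (\<Prod>i\<in>{..n} - {j}. \<bar>g j - g i\<bar>)"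
      by (simp add: node_prod_def prod.reindex[OF inj] abs_prod)
    also have "\<dots> = (\<Prod>i\<in>{..n} - {j}. h * \<bar>real j - real i\<bar>)"
      using h by (intro prod.cong refl) (simp add: g_def abs_mult flip: left_diff_distrib)
    also have "\<dots> = h ^ n * (fact j * fact (n - j))"
      using that by (simp add: prod.distrib prod_abs_diff_nat[OF that] card_Diff_singleton)
    finally have eq: "\<bar>node_prod (g ` {..n}) (g j)\<bar> = h ^ n * (fact j * fact (n - j))" .
    have "fact n = real (n choose j) * (fact j * fact (n - j))"
      using binomial_fact_lemma[OF that] by (metis of_nat_fact of_nat_mult mult.commute)
    also have "\<dots> \<le> 2 ^ n * (fact j * fact (n - j))"
      using binomial_le_pow2[of n j]
      by (intro mult_right_mono) (auto simp flip: of_nat_le_iff)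
    finally have f: "fact n \<le> 2 ^ n * (fact j * fact (n - j) :: real)" .
    have "(v - u) ^ n = h ^ n * real n ^ n"
      using False by (simp add: h_def power_divide)
    also have "\<dots> \<le> h ^ n * (2 ^ n * (fact j * fact (n - j)) * exp 1 ^ n)"
      using h power_self_le_fact_exp[of n] f
      by (intro mult_left_mono) (auto intro: order.trans mult_right_mono)
    finally show ?thesis unfolding eq using h assms
      by (simp add: field_simps power_mult_distrib power_divide)
  qed (use that in \<open>auto simp: node_prod_def\<close>)
  show ?thesis
    by (rule that[of "g ` {..n}"])
      (use bound le ge inj in \<open>auto simp: card_image\<close>)
qed

lemma node_prod_of_real:
  "node_prod (complex_of_real ` X) (complex_of_real x) = complex_of_real (node_prod X x)"
proof -
  have "complex_of_real ` X - {complex_of_real x} = complex_of_real ` (X - {x})"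
    by (auto simp: image_iff)
  then show ?thesis
    by (simp add: node_prod_def prod.reindex inj_on_def)
qed

lemma Suc_le_two_power: "real (Suc n) \<le> 2 ^ n"
  by (induction n) (auto simp: algebra_simps)

text \<open>Divided difference at equispaced nodes. The \<open>n + 1\<close> summands cost a factor
  of at most \<open>2 ^ n\<close>, which turns \<open>2 * exp 1\<close> into
  \<open>4 * exp 1\<close>.\<close>

lemma lead_coeff_le_sup_interval:
  fixes p :: "complex poly"
  assumes "u < v" "degree p \<le> n" "\<And>x. x \<in> {u..v} \<Longrightarrow> norm (poly p (of_real x)) \<le> K"
  shows "norm (coeff p n) \<le> K * (4 * exp 1 / (v - u)) ^ n"
proof -
  obtain X where X: "X \<subseteq> {u..v}" "card X = Suc n"
    "\<And>x. x \<in> X \<Longrightarrow> 1 / \<bar>node_prod X x\<bar> \<le> (2 * exp 1 / (v - u)) ^ n"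
    using ex_equispaced_nodes[OF \<open>u < v\<close>, of n] by blast
  have K: "0 \<le> K" using assms(1) assms(3)[of u] by (meson atLeastAtMost_iff less_imp_le norm_ge_zero order.refl order.trans)
  have "coeff p n = (\<Sum>x\<in>complex_of_real ` X. poly p x / node_prod (complex_of_real ` X) x)"
    using X by (intro coeff_eq_sum_node_prod assms) (simp add: card_image inj_on_def)
  also have "\<dots> = (\<Sum>x\<in>X. poly p (of_real x) / of_real (node_prod X x))"
    by (simp add: sum.reindex inj_on_def node_prod_of_real)
  also have "norm \<dots> \<le> (\<Sum>x\<in>X. K * (2 * exp 1 / (v - u)) ^ n)"
  proof (rule sum_norm_le)
    fix x assume x: "x \<in> X"
    have "norm (poly p (of_real x) / of_real (node_prod X x))
        = norm (poly p (of_real x)) * (1 / \<bar>node_prod X x\<bar>)"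
      by (simp add: norm_divide)
    also have "\<dots> \<le> K * (2 * exp 1 / (v - u)) ^ n"
      using x X K assms(3) by (intro mult_mono) auto
    finally show "norm (poly p (of_real x) / of_real (node_prod X x)) \<le> K * (2 * exp 1 / (v - u)) ^ n" .
  qed
  also have "\<dots> = real (Suc n) * (K * (2 * exp 1 / (v - u)) ^ n)"
    using X by simp
  also have "\<dots> \<le> 2 ^ n * (K * (2 * exp 1 / (v - u)) ^ n)"
    using K assms by (intro mult_right_mono Suc_le_two_power) auto
  also have "\<dots> = K * (4 * exp 1 / (v - u)) ^ n"
    by (simp flip: power_mult_distrib)
  finally show ?thesis .
qed

text \<open>Lagrange interpolation at equispaced nodes of \<open>{u..v}\<close>. Each of the
  \<open>n\<close> factors \<open>z - x\<close> costs at most 2, hence \<open>8 * exp 1\<close>.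
  This controls a polynomial in the gaps of \<open>E\<close> by its size on one interval of
  \<open>E\<close>.\<close>

lemma poly_le_sup_interval:
  fixes p :: "complex poly"
  assumes "u < v" "degree p \<le> n" "\<And>x. x \<in> {u..v} \<Longrightarrow> norm (poly p (of_real x)) \<le> K"
    and z: "\<And>x. x \<in> {u..v} \<Longrightarrow> \<bar>z - x\<bar> \<le> 2"
  shows "norm (poly p (of_real z)) \<le> K * (8 * exp 1 / (v - u)) ^ n"
proof -
  obtain X where X: "X \<subseteq> {u..v}" "card X = Suc n"
    "\<And>x. x \<in> X \<Longrightarrow> 1 / \<bar>node_prod X x\<bar> \<le> (2 * exp 1 / (v - u)) ^ n"
    using ex_equispaced_nodes[OF \<open>u < v\<close>, of n] by blast
  have fin: "finite X" using X card.infinite by fastforce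
  have K: "0 \<le> K" using assms(1) assms(3)[of u] by (meson atLeastAtMost_iff less_imp_le norm_ge_zero order.refl order.trans)
  have "poly p (of_real z) = poly (interp (complex_of_real ` X) (poly p)) (of_real z)"
    using X by (subst interp_poly[OF _ assms(2)]) (simp_all add: card_image inj_on_def)
  also have "\<dots> = (\<Sum>x\<in>X. poly p (of_real x) / of_real (node_prod X x) * of_real (\<Prod>y\<in>X - {x}. z - y))"
  proof -
    have "complex_of_real ` X - {complex_of_real x} = complex_of_real ` (X - {x})" for x
      by (auto simp: image_iff)
    then show ?thesis
      by (simp add: poly_interp_eq sum.reindex prod.reindex inj_on_def node_prod_of_real)
  qed
  also have "norm \<dots> \<le> (\<Sum>x\<in>X. K * (2 * exp 1 / (v - u)) ^ n * 2 ^ n)"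
  proof (rule sum_norm_le)
    fix x assume x: "x \<in> X"
    have "\<bar>\<Prod>y\<in>X - {x}. z - y\<bar> \<le> (\<Prod>y\<in>X - {x}. 2)"
      unfolding abs_prod using z X by (intro prod_mono) auto
    also have "\<dots> = 2 ^ n" using x X fin by simp
    finally have l: "\<bar>\<Prod>y\<in>X - {x}. z - y\<bar> \<le> 2 ^ n" .
    have "norm (poly p (of_real x) / of_real (node_prod X x) * of_real (\<Prod>y\<in>X - {x}. z - y))
        = norm (poly p (of_real x)) * (1 / \<bar>node_prod X x\<bar>) * \<bar>\<Prod>y\<in>X - {x}. z - y\<bar>"
      by (simp only: norm_divide norm_mult norm_of_real) simp
    also have "\<dots> \<le> K * (2 * exp 1 / (v - u)) ^ n * 2 ^ n"
      using x X K l assms(1,3) by (intro mult_mono) (auto intro!: divide_nonneg_nonneg)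
    finally show "norm (poly p (of_real x) / of_real (node_prod X x) * of_real (\<Prod>y\<in>X - {x}. z - y))
        \<le> K * (2 * exp 1 / (v - u)) ^ n * 2 ^ n" .
  qed
  also have "\<dots> = real (Suc n) * (K * (2 * exp 1 / (v - u)) ^ n * 2 ^ n)"
    using X by simp
  also have "\<dots> \<le> 2 ^ n * (K * (2 * exp 1 / (v - u)) ^ n * 2 ^ n)"
    using K assms by (intro mult_right_mono Suc_le_two_power) auto
  also have "\<dots> = K * (8 * exp 1 / (v - u)) ^ n"
    by (simp flip: power_mult_distrib)
  finally show ?thesis .
qed

subsection \<open>Alternation\<close>

text \<open>A list form of alternation that suits induction from the left; \<open>s\<close> is the
  sign expected at the head. Only the lower bound \<open>d\<close> is required, so points with
  larger values may be exchanged in.\<close>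

fun alternates :: "(real \<Rightarrow> real) \<Rightarrow> real \<Rightarrow> real \<Rightarrow> real list \<Rightarrow> bool" where
  "alternates f d s [] \<longleftrightarrow> True"
| "alternates f d s (x # xs) \<longleftrightarrow> d \<le> s * f x \<and> alternates f d (- s) xs"

lemma sgn_prod: "sgn (\<Prod>x\<in>A. f x) = (\<Prod>x\<in>A. sgn (f x :: real))"
  by (induction A rule: infinite_finite_induct) (auto simp: sgn_mult)

lemma sgn_node_prod_less:
  fixes x :: real
  assumes "finite A" "\<And>y. y \<in> A \<Longrightarrow> x < y"
  shows "sgn (node_prod (insert x A) x) = (-1) ^ card A"
proof -
  have "insert x A - {x} = A" using assms(2) by auto
  then have "sgn (node_prod (insert x A) x) = (\<Prod>y\<in>A. sgn (x - y))"
    by (simp add: node_prod_def sgn_prod)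
  also have "\<dots> = (\<Prod>y\<in>A. -1)"
    using assms(2) by (intro prod.cong) auto
  finally show ?thesis by simp
qed

lemma sgn_node_prod_greater:
  fixes x :: real
  assumes "finite A" "y \<in> A" "x < y" "x \<notin> A"
  shows "sgn (node_prod (insert x A) y) = sgn (node_prod A y)"
proof -
  have "insert x A - {y} = insert x (A - {y})" using assms by auto
  then show ?thesis using assms by (simp add: node_prod_def sgn_mult)
qed

text \<open>At an entry of an increasing list, the sign of \<open>node_prod\<close> is -1 to the
  number of larger entries, so it alternates along the list. The factor
  \<open>- (-1) ^ length xs\<close> normalises it to 1 at the head.\<close>

lemma alternates_iff:
  assumes "sorted_wrt (<) xs"
  shows "alternates f d s xs \<longleftrightarrow>
    (\<forall>x\<in>set xs. d \<le> - s * (-1) ^ length xs * sgn (node_prod (set xs) x) * f x)"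
  using assms
proof (induction xs arbitrary: s)
  case (Cons x xs)
  have 1: "sgn (node_prod (insert x (set xs)) x) = (-1) ^ length xs"
    using Cons.prems by (subst sgn_node_prod_less) (auto simp: distinct_card strict_sorted_iff)
  have 2: "sgn (node_prod (insert x (set xs)) y) = sgn (node_prod (set xs) y)" if "y \<in> set xs" for y
    using Cons.prems that by (intro sgn_node_prod_greater) auto
  have 3: "s * (-1) ^ length xs * (-1) ^ length xs = s"
    by (simp add: mult.assoc flip: power_add)
  show ?case using Cons 1 2 by (simp add: 3)
qed simp

text \<open>The single exchange of the Remez algorithm: \<open>z\<close> replaces a neighbour at
  which \<open>f\<close> has the same sign. That fails only if \<open>z\<close> lies beyond an end
  and has the sign opposite to that end; then \<open>z\<close> prolongs the alternation, which the
  last two alternatives record.\<close>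

lemma alternates_exchange:
  assumes "sorted_wrt (<) xs" "xs \<noteq> []" "alternates f d s xs" "z \<notin> set xs" "d \<le> \<bar>f z\<bar>" "\<bar>s\<bar> = 1"
  shows "(\<exists>ys. length ys = length xs \<and> sorted_wrt (<) ys \<and> set ys \<subseteq> insert z (set xs) \<and> z \<in> set ys
        \<and> alternates f d s ys)
    \<or> z < hd xs \<and> d \<le> - s * f z
    \<or> (\<forall>x\<in>set xs. x < z) \<and> alternates f d s (xs @ [z])"
  using assms
proof (induction xs arbitrary: s)
  case (Cons x xs)
  have alt: "alternates f d (- s) xs" and srt: "sorted_wrt (<) xs" "\<forall>y\<in>set xs. x < y"
    and x: "d \<le> s * f x" using Cons.prems by auto
  have zs: "d \<le> s * f z \<or> d \<le> - s * f z" using Cons.prems by (auto simp: abs_if split: if_splits)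
  consider "z < x" | "x < z" using Cons.prems by force
  then show ?case
  proof cases
    case 1
    from zs show ?thesis
    proof
      assume "d \<le> s * f z"
      then have "alternates f d s (z # xs)" using alt by simp
      then show ?thesis using srt 1 by (intro disjI1 exI[of _ "z # xs"]) auto
    qed (use 1 in auto)
  next
    case 2
    show ?thesis
    proof (cases "xs = []")
      case True
      from zs show ?thesis
      proof
        assume "d \<le> s * f z"
        then show ?thesis using True by (intro disjI1 exI[of _ "[z]"]) auto
      qed (use 2 True x in auto)
    next
      case False
      consider ys where "length ys = length xs" "sorted_wrt (<) ys" "set ys \<subseteq> insert z (set xs)"
          "z \<in> set ys" "alternates f d (- s) ys"
        | "z < hd xs" "d \<le> s * f z"
        | "\<forall>x\<in>set xs. x < z" "alternates f d (- s) (xs @ [z])"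
        using Cons.IH[of "- s"] Cons.prems srt alt False by auto
      then show ?thesis
      proof cases
        case (1 ys)
        then show ?thesis using srt 2 x by (intro disjI1 exI[of _ "x # ys"]) auto
      next
        \<comment> \<open>Here \<open>z\<close> lies between \<open>x\<close> and the next point and
          has the sign of \<open>x\<close>, so it takes the place of \<open>x\<close>.\<close>
        case h: 2
        have "hd xs \<le> y" if "y \<in> set xs" for y
          using that srt False by (cases xs) auto
        then have "sorted_wrt (<) (z # xs)" using srt h by force
        then show ?thesis using alt h(2) by (intro disjI1 exI[of _ "z # xs"]) auto
      next
        case 3
        then show ?thesis using 2 x by auto
      qed
    qed
  qed
qed simp

lemma alternation_exchange:
  assumes "finite X" "X \<noteq> {}" "\<And>x. x \<in> X \<Longrightarrow> d \<le> sgn (node_prod X x) * f x" "z \<notin> X" "d \<le> \<bar>f z\<bar>"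
  obtains Y s where "Y \<subseteq> insert z X" "z \<in> Y" "card Y = card X" "\<bar>s :: real\<bar> = 1"
    "\<And>y. y \<in> Y \<Longrightarrow> d \<le> s * sgn (node_prod Y y) * f y"
proof -
  define xs where "xs = sorted_list_of_set X"
  \<comment> \<open>This sign cancels the normalising factor of
    \<open>alternates_iff\<close>.\<close>
  define s where "s = - ((-1::real) ^ length xs)"
  have xs: "sorted_wrt (<) xs" "set xs = X" "xs \<noteq> []" using assms by (auto simp: xs_def)
  have s: "\<bar>s\<bar> = 1" by (simp add: s_def)
  have "- s * (-1) ^ length xs = 1" by (simp add: s_def flip: power_add)
  then have alt: "alternates f d s xs" using alternates_iff[OF xs(1)] xs assms by auto
  have z: "z \<notin> set xs" using assms(4) xs by simp
  have "\<exists>ys r. length ys = length xs \<and> sorted_wrt (<) ys \<and> set ys \<subseteq> insert z (set xs) \<and> z \<in> set ys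
      \<and> \<bar>r\<bar> = 1 \<and> alternates f d r ys"
    using alternates_exchange[OF xs(1,3) alt z assms(5) s]
  proof (elim disjE)
    \<comment> \<open>The alternation is prolonged at one end, so the point at the other end is
      dropped to keep the cardinality; the initial sign flips. The remaining case mirrors
      this.\<close>
    assume h: "z < hd xs \<and> d \<le> - s * f z"
    obtain as b where ab: "xs = as @ [b]" using xs(3) by (cases xs rule: rev_cases) auto
    have butlast: "alternates f d s (as @ cs) \<Longrightarrow> alternates f d s as" for as cs s
      by (induction as arbitrary: s) auto
    have "z < y" if "y \<in> set xs" for y
      using that h xs by (cases xs) auto
    then show ?thesis
      using h ab xs alt s butlast[of s as "[b]"]
      by (intro exI[of _ "z # as"] exI[of _ "- s"]) (auto simp: sorted_wrt_append)
  next
    assume h: "(\<forall>x\<in>set xs. x < z) \<and> alternates f d s (xs @ [z])"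
    obtain a bs where "xs = a # bs" using xs(3) by (cases xs) auto
    then show ?thesis using h xs s
      by (intro exI[of _ "bs @ [z]"] exI[of _ "- s"]) (auto simp: sorted_wrt_append)
  qed (use s in blast)
  then obtain ys r where ys: "length ys = length xs" "sorted_wrt (<) ys" "set ys \<subseteq> insert z X" "z \<in> set ys"
    "\<bar>r\<bar> = 1" "alternates f d r ys" using xs by auto
  show ?thesis
  proof (rule that[of "set ys" "- r * (-1) ^ length ys"])
    show "card (set ys) = card X"
      using ys xs by (metis distinct_card strict_sorted_iff)
    show "d \<le> - r * (- 1) ^ length ys * sgn (node_prod (set ys) y) * f y" if "y \<in> set ys" for y
      using alternates_iff[OF ys(2), of f d r] ys(6) that by blast
  qed (use ys in \<open>auto simp: abs_mult\<close>)
qed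

lemma ex_alternating_poly_finite:
  fixes F :: "real set"
  assumes "finite F" "Suc n \<le> card F"
  obtains X T d where "X \<subseteq> F" "card X = Suc n" "0 < d" "degree T \<le> n" "coeff T n = 1"
    "\<And>x. x \<in> X \<Longrightarrow> poly T x = d * sgn (node_prod X x)" "\<And>x. x \<in> F \<Longrightarrow> \<bar>poly T x\<bar> \<le> d"
proof -
  \<comment> \<open>The smallest possible deviation on \<open>n + 1\<close> nodes \<open>X\<close> is \<open>1 / w X\<close>; we take the nodes in \<open>F\<close> that
    are worst in this sense, and show that the exchange of a node would make them worse still.\<close>
  define w where "w X = (\<Sum>x\<in>X. 1 / \<bar>node_prod X x\<bar>)" for X :: "real set"
  define P where "P = {X. X \<subseteq> F \<and> card X = Suc n}"
  have "finite P" using assms by (auto simp: P_def)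
  moreover have "P \<noteq> {}" using obtain_subset_with_card_n[OF assms(2)] by (auto simp: P_def)
  ultimately obtain X where X: "X \<in> P" "\<And>Y. Y \<in> P \<Longrightarrow> w X \<le> w Y"
    using arg_min_if_finite[of P w] by (meson not_le)
  have XF: "X \<subseteq> F" "card X = Suc n" using X by (auto simp: P_def)
  have fin: "finite X" "X \<noteq> {}" using XF assms finite_subset by auto
  have w: "0 < w X" unfolding w_def
    using fin by (intro sum_pos) (auto simp: node_prod_nonzero)
  \<comment> \<open>Prescribing the values \<open>d * sgn (node_prod X x)\<close> makes the top
    coefficient \<open>d * w X\<close>; this \<open>d\<close> makes it 1.\<close>
  define d where "d = 1 / w X"
  have d: "0 < d" using w by (simp add: d_def)
  define T where "T = interp X (\<lambda>x. d * sgn (node_prod X x))"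
  have TX: "poly T x = d * sgn (node_prod X x)" if "x \<in> X" for x
    using that fin by (simp add: T_def poly_interp)
  have degT: "degree T \<le> n" using degree_interp XF by (simp add: T_def)
  have coeffT: "coeff T n = 1"
  proof -
    have "coeff T n = (\<Sum>x\<in>X. d * (1 / \<bar>node_prod X x\<bar>))"
      unfolding T_def coeff_interp[OF XF(2)]
      using fin by (intro sum.cong) (auto simp: node_prod_nonzero sgn_if)
    also have "\<dots> = d * w X" by (simp only: w_def sum_distrib_left)
    also have "\<dots> = 1" using w by (simp add: d_def)
    finally show ?thesis .
  qed
  have "\<bar>poly T z\<bar> \<le> d" if z: "z \<in> F" for z
  proof (rule ccontr)
    assume gt: "\<not> \<bar>poly T z\<bar> \<le> d"
    have "\<bar>sgn (node_prod X x)\<bar> = 1" if "x \<in> X" for x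
      using node_prod_nonzero[OF fin(1), of x] by (simp add: sgn_if)
    then have "z \<notin> X" using gt TX d by (auto simp: abs_mult)
    moreover have "d \<le> sgn (node_prod X x) * poly T x" if "x \<in> X" for x
      using that node_prod_nonzero[OF fin(1), of x] by (simp add: TX sgn_if)
    ultimately obtain Y s where Y: "Y \<subseteq> insert z X" "z \<in> Y" "card Y = card X" "\<bar>s\<bar> = 1"
      "\<And>y. y \<in> Y \<Longrightarrow> d \<le> s * sgn (node_prod Y y) * poly T y"
      using alternation_exchange[of X d "poly T" z] fin gt by auto
    have finY: "finite Y" using Y(1) fin finite_subset by blast
    have "Y \<in> P" using Y z XF by (auto simp: P_def)
    \<comment> \<open>By alternation all terms of the divided difference of \<open>T\<close> over
      \<open>Y\<close> have the sign \<open>s\<close>, so their moduli add up to the top coefficient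
      1. As the values are at least \<open>d\<close> in modulus, and larger at \<open>z\<close>,
      this gives \<open>w Y * d < 1\<close>, against the minimality of \<open>w X\<close>.\<close>
    have "w Y * d = (\<Sum>y\<in>Y. d / \<bar>node_prod Y y\<bar>)"
      by (simp add: w_def sum_distrib_right)
    also have "\<dots> < (\<Sum>y\<in>Y. \<bar>poly T y\<bar> / \<bar>node_prod Y y\<bar>)"
    proof (rule sum_strict_mono_ex1)
      have "d \<le> \<bar>poly T y\<bar>" if "y \<in> Y" for y
      proof -
        have "d \<le> \<bar>s * sgn (node_prod Y y) * poly T y\<bar>" using Y(5)[OF that] by linarith
        also have "\<dots> = \<bar>poly T y\<bar>" using Y(4) node_prod_nonzero[OF finY, of y]
          by (simp add: abs_mult sgn_if)
        finally show ?thesis .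
      qed
      then show "\<forall>y\<in>Y. d / \<bar>node_prod Y y\<bar> \<le> \<bar>poly T y\<bar> / \<bar>node_prod Y y\<bar>"
        by (auto intro: divide_right_mono)
      show "\<exists>y\<in>Y. d / \<bar>node_prod Y y\<bar> < \<bar>poly T y\<bar> / \<bar>node_prod Y y\<bar>"
        using Y(2) gt node_prod_nonzero[OF finY, of z]
        by (intro bexI[of _ z]) (auto intro!: divide_strict_right_mono)
    qed (fact finY)
    also have "\<dots> = s * (\<Sum>y\<in>Y. poly T y / node_prod Y y)"
      unfolding sum_distrib_left
    proof (rule sum.cong[OF refl])
      fix y assume y: "y \<in> Y"
      have "0 \<le> s * sgn (node_prod Y y) * poly T y" using Y(5)[OF y] d by linarith
      then show "\<bar>poly T y\<bar> / \<bar>node_prod Y y\<bar> = s * (poly T y / node_prod Y y)"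
        using Y(4) node_prod_nonzero[OF finY, of y]
        by (auto simp: sgn_if abs_if zero_le_mult_iff mult_le_0_iff split: if_splits)
    qed
    also have "\<dots> = s"
      using coeff_eq_sum_node_prod[of Y n T] Y(3) XF degT coeffT by simp
    also have "\<dots> \<le> 1" using Y(4) by linarith
    finally have "w Y < w X" using d w by (simp add: d_def field_simps)
    then show False using X(2)[OF \<open>Y \<in> P\<close>] by simp
  qed
  then show ?thesis using that XF d degT coeffT TX by blast
qed

section \<open>Real roots of level equations and passage to compact sets\<close>

text \<open>The intermediate value theorem gives a root between consecutive points, strictly so
  because \<open>\<bar>y\<bar> < d\<close>. The location clauses carry the induction: the head of
  the tail separates the new root from all earlier ones.\<close>

lemma ex_interlacing_solutions:
  fixes f :: "real \<Rightarrow> real"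
  assumes "sorted_wrt (<) xs" "xs \<noteq> []" "alternates f d s xs" "\<bar>s\<bar> = 1" "\<bar>y\<bar> < d"
    and cont: "continuous_on UNIV f"
  shows "\<exists>Z. finite Z \<and> Suc (card Z) = length xs \<and> (\<forall>r\<in>Z. f r = y \<and> hd xs < r \<and> (\<exists>x\<in>set xs. r < x)) \<and>
    (\<forall>r\<in>Z. \<forall>r'\<in>Z. r < r' \<longrightarrow> (\<exists>x\<in>set xs. r < x \<and> x < r'))"
  using assms(1-4)
proof (induction xs arbitrary: s)
  case (Cons a xs)
  show ?case
  proof (cases xs)
    case Nil
    then show ?thesis by (intro exI[of _ "{}"]) auto
  next
    case (Cons b bs)
    have alt: "alternates f d (- s) xs" "d \<le> s * f a" "d \<le> - s * f b"
      and ab: "a < b" and srt: "sorted_wrt (<) xs"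
      using Cons.prems Cons by auto
    obtain Z where Z: "finite Z" "Suc (card Z) = length xs"
      "\<forall>r\<in>Z. f r = y \<and> b < r \<and> (\<exists>x\<in>set xs. r < x)"
      "\<forall>r\<in>Z. \<forall>r'\<in>Z. r < r' \<longrightarrow> (\<exists>x\<in>set xs. r < x \<and> x < r')"
      using Cons.IH[OF srt _ alt(1)] Cons Cons.prems by auto
    have "\<exists>r. a < r \<and> r < b \<and> f r = y"
    proof -
      have s: "s = 1 \<or> s = - 1" using Cons.prems by linarith
      then have "\<exists>r\<ge>a. r \<le> b \<and> f r = y"
      proof
        assume "s = 1"
        then show ?thesis using alt ab assms(5)
          by (intro IVT2') (auto intro: continuous_on_subset[OF cont])
      next
        assume "s = - 1"
        then show ?thesis using alt ab assms(5)
          by (intro IVT') (auto intro: continuous_on_subset[OF cont])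
      qed
      then obtain r where r: "a \<le> r" "r \<le> b" "f r = y" by auto
      have "r \<noteq> a" "r \<noteq> b" using r alt s assms(5) by auto
      then show ?thesis using r by force
    qed
    then obtain r where r: "a < r" "r < b" "f r = y" by auto
    have b: "b \<in> set xs" using Cons by simp
    have "r \<notin> Z" using r(2) Z(3) order.asym by blast
    have sol: "\<forall>r'\<in>insert r Z. f r' = y \<and> hd (a # xs) < r' \<and> (\<exists>x\<in>set (a # xs). r' < x)"
    proof (intro ballI)
      fix r' assume "r' \<in> insert r Z"
      then consider "r' = r" | "r' \<in> Z" by blast
      then show "f r' = y \<and> hd (a # xs) < r' \<and> (\<exists>x\<in>set (a # xs). r' < x)"
      proof cases
        case 1
        then show ?thesis using r b by auto
      next
        case 2
        then have "f r' = y" "b < r'" "\<exists>x\<in>set xs. r' < x" using Z(3) by blast+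
        then show ?thesis using ab by simp
      qed
    qed
    have sep: "\<forall>r1\<in>insert r Z. \<forall>r2\<in>insert r Z. r1 < r2 \<longrightarrow> (\<exists>x\<in>set (a # xs). r1 < x \<and> x < r2)"
    proof (intro ballI impI)
      fix r1 r2 assume h: "r1 \<in> insert r Z" "r2 \<in> insert r Z" "r1 < r2"
      have gt: "r < r'" if "r' \<in> Z" for r' using that r Z(3) order.strict_trans by blast
      have "r2 \<noteq> r" using gt[of r1] h by auto
      then consider "r1 \<in> Z" "r2 \<in> Z" | "r1 = r" "r2 \<in> Z" using h by blast
      then show "\<exists>x\<in>set (a # xs). r1 < x \<and> x < r2"
      proof cases
        case 1
        then have "\<exists>x\<in>set xs. r1 < x \<and> x < r2" using Z(4) h(3) by blast
        then show ?thesis by auto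
      next
        case 2
        then have "r1 < b \<and> b < r2" using Z(3) r by blast
        then show ?thesis using b by auto
      qed
    qed
    have "Suc (card (insert r Z)) = length (a # xs)" using \<open>r \<notin> Z\<close> Z(1,2) by simp
    then show ?thesis using Z(1) sol sep by (intro exI[of _ "insert r Z"]) blast
  qed
qed simp

lemma monic_eq_prod_linear:
  fixes p :: "'a::field poly"
  assumes "degree p \<le> n" "coeff p n = 1" "finite Z" "card Z = n" "\<And>z. z \<in> Z \<Longrightarrow> poly p z = 0"
  shows "p = (\<Prod>z\<in>Z. [:- z, 1:])"
  using assms
  by (intro poly_eqI_degree_lead_coeff[of _ n _ Z])
    (auto simp: lead_coeff_prod_linear degree_prod_linear poly_prod intro!: prod_zero)

text \<open>The \<open>n\<close> roots supplied by alternation exhaust the degree, so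
  \<open>T = y\<close> has no others and all of them are real and simple.\<close>

lemma alternating_poly_factors:
  fixes T :: "real poly"
  assumes "card X = Suc n" "n \<ge> 1" "degree T \<le> n" "coeff T n = 1"
    and alt: "\<And>x. x \<in> X \<Longrightarrow> poly T x = d * sgn (node_prod X x)" and y: "\<bar>y\<bar> < d"
  obtains Z where "finite Z" "card Z = n" "T - [:y:] = (\<Prod>z\<in>Z. [:- z, 1:])"
    "\<And>z. z \<in> Z \<Longrightarrow> \<exists>a\<in>X. \<exists>b\<in>X. a < z \<and> z < b"
    "\<And>z z'. z \<in> Z \<Longrightarrow> z' \<in> Z \<Longrightarrow> z < z' \<Longrightarrow> \<exists>x\<in>X. z < x \<and> x < z'"
proof -
  have fin: "finite X" using assms card.infinite by fastforce
  define xs where "xs = sorted_list_of_set X"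
  define s where "s = - ((-1::real) ^ length xs)"
  have xs: "sorted_wrt (<) xs" "set xs = X" "xs \<noteq> []" "length xs = Suc n"
    using assms(1) fin by (auto simp: xs_def)
  have s: "\<bar>s\<bar> = 1" by (simp add: s_def)
  have "- s * (-1) ^ length xs = 1" by (simp add: s_def flip: power_add)
  then have "alternates (poly T) d s xs"
    unfolding alternates_iff[OF xs(1)] xs(2)
    using node_prod_nonzero[OF fin] alt by (auto simp: sgn_if)
  from ex_interlacing_solutions[OF xs(1,3) this s y continuous_on_poly[OF continuous_on_id]]
  obtain Z where Z: "finite Z" "Suc (card Z) = length xs"
      "\<forall>r\<in>Z. poly T r = y \<and> hd xs < r \<and> (\<exists>x\<in>X. r < x)"
      "\<forall>r\<in>Z. \<forall>r'\<in>Z. r < r' \<longrightarrow> (\<exists>x\<in>X. r < x \<and> x < r')"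
    unfolding xs(2) by blast
  show ?thesis
  proof (rule that[of Z])
    show "T - [:y:] = (\<Prod>z\<in>Z. [:- z, 1:])"
      using Z xs assms(2-4)
      by (intro monic_eq_prod_linear[of _ n]) (auto intro!: degree_diff_le simp: coeff_pCons split: nat.splits)
    show "\<exists>a\<in>X. \<exists>b\<in>X. a < z \<and> z < b" if "z \<in> Z" for z
      using Z(3) that xs by (metis hd_in_set)
  qed (use Z xs in auto)
qed

text \<open>The finite case is applied to a fine net of \<open>E\<close>. All roots of
  \<open>T\<close> lie in [-1, 1], so \<open>T\<close> has a Lipschitz bound there depending only on
  \<open>n\<close>, and the loss off the net is at most \<open>e\<close>.\<close>

lemma ex_alternating_poly:
  fixes E :: "real set"
  assumes E: "compact E" "infinite E" "E \<subseteq> {-1..1}" and "n \<ge> 1" "0 < e"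
  obtains X T d Z where "X \<subseteq> E" "card X = Suc n" "0 < d" "degree T \<le> n" "coeff T n = 1"
    "\<And>x. x \<in> X \<Longrightarrow> poly T x = d * sgn (node_prod X x)" "\<And>x. x \<in> E \<Longrightarrow> \<bar>poly T x\<bar> \<le> d + e"
    "finite Z" "card Z = n" "T = (\<Prod>z\<in>Z. [:- z, 1:])"
proof -
  \<comment> \<open>The halved factors \<open>(t - z) / 2\<close> have modulus at most 1, so
    \<open>T\<close> changes by at most \<open>2 ^ n * n * h\<close> over a distance below
    \<open>h\<close>.\<close>
  define h where "h = e / (real n * 2 ^ n)"
  have h: "0 < h" using assms by (simp add: h_def)
  obtain F0 where F0: "finite F0" "F0 \<subseteq> E" "E \<subseteq> (\<Union>x\<in>F0. ball x h)"
    using seq_compact_imp_totally_bounded[of E] E(1) h unfolding compact_eq_seq_compact_metric by blast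
  \<comment> \<open>These points only ensure that the net has at least \<open>n + 1\<close>
    elements.\<close>
  obtain F1 where F1: "finite F1" "card F1 = Suc n" "F1 \<subseteq> E"
    using infinite_arbitrarily_large[OF E(2)] by blast
  define F where "F = F0 \<union> F1"
  have F: "finite F" "F \<subseteq> E" "E \<subseteq> (\<Union>x\<in>F. ball x h)" using F0 F1 by (auto simp: F_def)
  have cardF: "Suc n \<le> card F" using F1 F(1) card_mono[of F F1] by (auto simp: F_def)
  obtain X T d where XT: "X \<subseteq> F" "card X = Suc n" "0 < d" "degree T \<le> n" "coeff T n = 1"
      "\<And>x. x \<in> X \<Longrightarrow> poly T x = d * sgn (node_prod X x)" "\<And>x. x \<in> F \<Longrightarrow> \<bar>poly T x\<bar> \<le> d"
    by (rule ex_alternating_poly_finite[OF F(1) cardF]) (rule that)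
  obtain Z where Z: "finite Z" "card Z = n" "T - [:0:] = (\<Prod>z\<in>Z. [:- z, 1:])"
    "\<And>z. z \<in> Z \<Longrightarrow> \<exists>a\<in>X. \<exists>b\<in>X. a < z \<and> z < b"
    using alternating_poly_factors[of X n T d 0] XT \<open>n \<ge> 1\<close> by auto
  have Z1: "\<bar>z\<bar> \<le> 1" if z: "z \<in> Z" for z
  proof -
    obtain a b where "a \<in> X" "b \<in> X" "a < z" "z < b" using Z(4)[OF z] by blast
    moreover have "X \<subseteq> {-1..1}" using XT(1) F(2) E(3) by blast
    then have "-1 \<le> a" "b \<le> 1" using calculation by auto
    ultimately show ?thesis by auto
  qed
  have T: "T = (\<Prod>z\<in>Z. [:- z, 1:])" using Z(3) by simp
  have "\<bar>poly T x\<bar> \<le> d + e" if x: "x \<in> E" for x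
  proof -
    obtain y where y: "y \<in> F" "\<bar>x - y\<bar> < h" using F(3) x by (auto simp: dist_real_def)
    have poly_T: "poly T t = 2 ^ n * (\<Prod>z\<in>Z. (t - z) / 2)" for t
      using Z(1,2) by (simp add: T poly_prod prod_dividef)
    have *: "norm ((t - z) / 2) \<le> 1" if "z \<in> Z" "t \<in> E" for z t
    proof -
      have "t \<in> {-1..1}" using that(2) E(3) by blast
      then have "\<bar>t\<bar> \<le> 1" by auto
      then show ?thesis using Z1[OF that(1)] abs_triangle_ineq4[of t z] by simp
    qed
    have "norm ((\<Prod>z\<in>Z. (x - z) / 2) - (\<Prod>z\<in>Z. (y - z) / 2)) \<le> (\<Sum>z\<in>Z. norm ((x - z) / 2 - (y - z) / 2))"
      using * x y(1) F(2) by (intro norm_prod_diff) blast+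
    also have "\<dots> = n * (\<bar>x - y\<bar> / 2)"
      using Z by (simp flip: diff_divide_distrib)
    also have "\<dots> \<le> n * h" using y(2) by (intro mult_left_mono) auto
    finally have "2 ^ n * \<bar>(\<Prod>z\<in>Z. (x - z) / 2) - (\<Prod>z\<in>Z. (y - z) / 2)\<bar> \<le> 2 ^ n * (n * h)"
      by (intro mult_left_mono) auto
    also have "\<dots> = e" using \<open>n \<ge> 1\<close> by (simp add: h_def)
    finally have "\<bar>poly T x - poly T y\<bar> \<le> e"
      by (simp add: poly_T abs_mult flip: right_diff_distrib)
    then show ?thesis using XT(7)[OF y(1)] by linarith
  qed
  then show ?thesis using that[of X d T Z] XT Z(1,2) T F(2) by blast
qed

subsection \<open>The product over the roots of a level equation\<close>

lemma complex_poly_eqI_of_real: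
  fixes p q :: "complex poly"
  assumes "\<And>x. poly p (of_real x) = poly q (of_real x)"
  shows "p = q"
proof (rule ccontr)
  assume "p \<noteq> q"
  then have "finite {z. poly (p - q) z = 0}" by (intro poly_roots_finite) simp
  moreover have "range complex_of_real \<subseteq> {z. poly (p - q) z = 0}" using assms by auto
  ultimately have "finite (range complex_of_real)" using finite_subset by blast
  then show False by (auto dest!: finite_imageD simp: inj_on_def infinite_UNIV_char_0)
qed

text \<open>Carries a real factorisation over to complex arguments: it is evaluated at the roots
  \<open>\<eta> i\<close>, which need not be real.\<close>

lemma prod_complex_shift:
  fixes Y Z :: "real set"
  assumes "(\<Prod>z\<in>Z. [:- z, 1:]) - [:y:] = (\<Prod>z\<in>Y. [:- z, 1:])"
  shows "(\<Prod>z\<in>Z. w - complex_of_real z) - of_real y = (\<Prod>z\<in>Y. w - complex_of_real z)"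
proof -
  have "(\<Prod>z\<in>Z. [:- complex_of_real z, 1:]) - [:of_real y:] = (\<Prod>z\<in>Y. [:- complex_of_real z, 1:])"
  proof (rule complex_poly_eqI_of_real)
    fix x
    have "(\<Prod>z\<in>Z. x - z) - y = (\<Prod>z\<in>Y. x - z)"
      using arg_cong[OF assms, of "\<lambda>p. poly p x"] by (simp add: poly_prod)
    then have "complex_of_real ((\<Prod>z\<in>Z. x - z) - y) = of_real (\<Prod>z\<in>Y. x - z)" by simp
    then show "poly ((\<Prod>z\<in>Z. [:- complex_of_real z, 1:]) - [:of_real y:]) (of_real x)
        = poly (\<Prod>z\<in>Y. [:- complex_of_real z, 1:]) (of_real x)"
      by (simp add: poly_prod)
  qed
  from arg_cong[OF this, of "\<lambda>p. poly p w"] show ?thesis by (simp add: poly_prod)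
qed

text \<open>What the gaps of \<open>E\<close> contribute: of the roots of \<open>T = y\<close>,
  which are separated by points of \<open>E\<close>, at most \<open>G\<close> lie outside
  \<open>E\<close>, whatever the degree.\<close>

definition separated_outside_le :: "real set \<Rightarrow> nat \<Rightarrow> bool" where
  "separated_outside_le E G \<longleftrightarrow> (\<forall>Y. finite Y \<longrightarrow>
     (\<forall>r\<in>Y. \<forall>r'\<in>Y. r < r' \<longrightarrow> (\<exists>x\<in>E. r < x \<and> x < r')) \<longrightarrow> card (Y - E) \<le> G)"

lemma one_le_exp_div_length:
  fixes u v :: real
  assumes "u \<in> {-1..1}" "v \<in> {-1..1}" "u < v"
  shows "1 \<le> 8 * exp 1 / (v - u)"
proof -
  have "v - u \<le> 8 * 1" using assms by auto
  also have "8 * 1 \<le> 8 * exp (1::real)" by (intro mult_left_mono) auto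
  finally show ?thesis using assms by simp
qed

lemma alternation_le_sup:
  fixes E :: "real set" and \<eta> :: "nat \<Rightarrow> complex"
  assumes E: "E \<subseteq> {-1..1}" "{u..v} \<subseteq> E" "u < v"
    and sep: "separated_outside_le E G"
    and T: "X \<subseteq> E" "card X = Suc n" "n \<ge> 1" "degree T \<le> n" "coeff T n = 1" "0 < d"
      "\<And>x. x \<in> X \<Longrightarrow> poly T x = d * sgn (node_prod X x)"
      "T = (\<Prod>z\<in>Z. [:- z, 1:])"
    and K: "\<And>x. x \<in> E \<Longrightarrow> (\<Prod>i<m. norm (of_real x - \<eta> i)) \<le> K"
  shows "d ^ m \<le> K ^ n * (4 * exp 1 * (8 * exp 1 / (v - u)) ^ G) ^ m"
proof -
  define M where "M = 8 * exp 1 / (v - u)"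
  have uv: "u \<in> E" "v \<in> E" using E(2,3) by auto
  then have "u \<in> {-1..1}" "v \<in> {-1..1}" using E(1) by blast+
  then have M: "1 \<le> M" unfolding M_def using E(3) by (rule one_le_exp_div_length)
  have K0: "0 \<le> K" using order.trans[OF prod_nonneg K[OF uv(1)]] by simp
  define R where "R = (\<Prod>i<m. [:- \<eta> i, 1:])"
  have degR: "degree R \<le> m" using degree_prod_linear[of "{..<m}" \<eta>] by (simp add: R_def)
  have RE: "norm (poly R (of_real x)) \<le> K" if "x \<in> E" for x
    using K[OF that] by (simp add: R_def poly_prod prod_norm)
  have R1: "norm (poly R (of_real x)) \<le> K * M ^ m" if "x \<in> {-1..1}" for x
    unfolding M_def
  proof (rule poly_le_sup_interval[OF E(3) degR])
    show "norm (poly R (of_real t)) \<le> K" if "t \<in> {u..v}" for t using RE that E(2) by blast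
    show "\<bar>x - t\<bar> \<le> 2" if "t \<in> {u..v}" for t
    proof -
      have "t \<in> {-1..1}" using that E by blast
      then show ?thesis using \<open>x \<in> {-1..1}\<close> by auto
    qed
  qed
  \<comment> \<open>Up to sign, \<open>p y\<close> is the product of \<open>R\<close> over the roots
    of \<open>T = y\<close>; written through the values of \<open>T\<close> at the roots of
    \<open>R\<close>, it is visibly monic of degree \<open>m\<close> in \<open>y\<close>.\<close>
  define p where "p = (\<Prod>i<m. [:- (\<Prod>z\<in>Z. \<eta> i - complex_of_real z), 1:])"
  \<comment> \<open>Halving the range keeps \<open>\<bar>y\<bar> < d\<close>, as the interlacing
    roots require, and leaves an interval of length \<open>d\<close>.\<close>
  have bound: "norm (poly p (of_real y)) \<le> K ^ n * M ^ (m * G)" if y: "y \<in> {- d / 2..d / 2}" for y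
  proof -
    have "\<bar>y\<bar> < d" using y T(6) by auto
    then obtain Y where Y: "finite Y" "card Y = n" "T - [:y:] = (\<Prod>z\<in>Y. [:- z, 1:])"
        "\<And>z. z \<in> Y \<Longrightarrow> \<exists>a\<in>X. \<exists>b\<in>X. a < z \<and> z < b"
        "\<And>z z'. z \<in> Y \<Longrightarrow> z' \<in> Y \<Longrightarrow> z < z' \<Longrightarrow> \<exists>x\<in>X. z < x \<and> x < z'"
      using alternating_poly_factors[OF T(2-5,7)] by blast
    have Y1: "Y \<subseteq> {-1..1}"
    proof
      fix z assume "z \<in> Y"
      then obtain a b where "a \<in> X" "b \<in> X" "a < z" "z < b" using Y(4) by blast
      moreover have "-1 \<le> a" "b \<le> 1" using calculation T(1) E(1) by auto
      ultimately show "z \<in> {-1..1}" by auto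
    qed
    have "\<forall>r\<in>Y. \<forall>r'\<in>Y. r < r' \<longrightarrow> (\<exists>x\<in>E. r < x \<and> x < r')"
      using Y(5) T(1) by blast
    then have cardY: "card (Y - E) \<le> G" using sep Y(1) by (auto simp: separated_outside_le_def)
    have "norm (poly p (of_real y)) = (\<Prod>i<m. norm (of_real y - (\<Prod>z\<in>Z. \<eta> i - complex_of_real z)))"
      by (simp add: p_def poly_prod prod_norm)
    \<comment> \<open>As for a resultant, \<open>T - y\<close> is factored over \<open>Y\<close> at
      each \<open>\<eta> i\<close>, and exchanging the two products yields values of
      \<open>R\<close>.\<close>
    also have "\<dots> = (\<Prod>i<m. norm (\<Prod>z\<in>Y. \<eta> i - complex_of_real z))"
      using prod_complex_shift[OF Y(3)[unfolded T(8)]]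
      by (intro prod.cong refl) (metis norm_minus_commute)
    also have "\<dots> = (\<Prod>i<m. \<Prod>z\<in>Y. norm (complex_of_real z - \<eta> i))"
      by (simp add: norm_minus_commute flip: prod_norm)
    also have "\<dots> = (\<Prod>z\<in>Y. norm (poly R (of_real z)))"
      by (subst prod.swap) (simp add: R_def poly_prod prod_norm)
    also have "\<dots> \<le> (\<Prod>z\<in>Y. K * (if z \<in> E then 1 else M ^ m))"
      using RE R1 Y1 by (intro prod_mono) auto
    also have "\<dots> = K ^ n * (M ^ m) ^ card (Y - E)"
      using Y(1,2) by (simp add: prod.distrib prod.If_cases Diff_eq)
    also have "\<dots> = K ^ n * M ^ (m * card (Y - E))" by (simp add: power_mult)
    also have "\<dots> \<le> K ^ n * M ^ (m * G)"
      using K0 M cardY by (intro mult_left_mono power_increasing mult_le_mono) auto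
    finally show ?thesis .
  qed
  have "norm (coeff p m) \<le> K ^ n * M ^ (m * G) * (4 * exp 1 / (d / 2 - - d / 2)) ^ m"
  proof (rule lead_coeff_le_sup_interval)
    show "degree p \<le> m" unfolding p_def by (subst degree_prod_linear) auto
  qed (use T(6) bound in auto)
  moreover have "coeff p m = 1"
    unfolding p_def
    using lead_coeff_prod_linear[of "{..<m}" "\<lambda>i. \<Prod>z\<in>Z. \<eta> i - complex_of_real z"] by simp
  ultimately have "1 \<le> K ^ n * M ^ (m * G) * (4 * exp 1 / d) ^ m" by simp
  then have "d ^ m \<le> K ^ n * M ^ (m * G) * (4 * exp 1) ^ m"
    using T(6) by (simp add: power_divide field_simps)
  also have "\<dots> = K ^ n * (4 * exp 1 * M ^ G) ^ m"
    by (simp add: power_mult_distrib mult_ac flip: power_mult)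
  finally show ?thesis by (simp add: M_def)
qed

subsection \<open>Minimum deviation on the unit circle\<close>

lemma ex_unit_circle_Re:
  assumes "x \<in> {-1..1}"
  obtains z where "norm z = 1" "Re z = x"
proof -
  have "\<bar>x\<bar> \<le> 1" using assms by auto
  then have "x\<^sup>2 \<le> 1" by (simp add: abs_square_le_1)
  then show ?thesis using that[of "Complex x (sqrt (1 - x\<^sup>2))"] by (simp add: cmod_def)
qed

lemma unit_circle_le_imp_interval_le:
  fixes E :: "real set" and Q :: "complex poly"
  assumes E: "E \<subseteq> {-1..1}" and Q: "degree Q = D" "coeff Q D = 1"
    and q: "\<And>z. norm z = 1 \<Longrightarrow> Re z \<in> E \<Longrightarrow> norm (poly Q z) \<le> q"
  obtains \<eta> where "\<And>x. x \<in> E \<Longrightarrow> (\<Prod>i<Suc D. norm (complex_of_real x - \<eta> i)) \<le> 4 * q\<^sup>2 / 2 ^ Suc D"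
proof -
  \<comment> \<open>The reflected summand makes the constant coefficient 1, so the roots have product of modulus 1;
    otherwise roots of \<open>Q\<close> near 0 would spoil the leading coefficient of the polynomial in \<open>x\<close>.\<close>
  define P where "P = pCons 0 Q + reflect_poly Q"
  have Q0: "Q \<noteq> 0" using Q by auto
  have degR: "degree (reflect_poly Q) < Suc D" using degree_reflect_poly_le[of Q] Q by simp
  have degP: "degree P = Suc D"
    unfolding P_def using degR Q0 Q by (subst degree_add_eq_left) auto
  have leadP: "lead_coeff P = 1"
    unfolding degP using degR Q by (simp add: P_def coeff_eq_0)
  obtain \<xi> where "smult (lead_coeff P) (\<Prod>i<degree P. [:- \<xi> i, 1:]) = P"
    by (rule complex_poly_decompose')
  then have P: "P = (\<Prod>i<Suc D. [:- \<xi> i, 1:])" using leadP degP by simp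
  have "poly P 0 = 1" using Q by (simp add: P_def)
  then have \<xi>1: "(\<Prod>i<Suc D. - \<xi> i) = 1" unfolding P poly_prod by simp
  have \<xi>0: "\<xi> i \<noteq> 0" if "i < Suc D" for i
  proof
    assume "\<xi> i = 0"
    then have "(\<Prod>i<Suc D. - \<xi> i) = 0" using that by (intro prod_zero) auto
    then have "(0::complex) = 1" by (subst (asm) \<xi>1) (rule sym)
    then show False by simp
  qed
  \<comment> \<open>The Joukowski image of \<open>\<xi> i\<close>: for \<open>z\<close> on the unit
    circle over \<open>x\<close>, the factors of \<open>P\<close> at \<open>z\<close> and at its
    conjugate multiply to \<open>- 2 * \<xi> i * (x - \<eta> i)\<close>.\<close>
  define \<eta> where "\<eta> i = (\<xi> i + 1 / \<xi> i) / 2" for i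
  have "(\<Prod>i<Suc D. norm (complex_of_real x - \<eta> i)) \<le> 4 * q\<^sup>2 / 2 ^ Suc D" if x: "x \<in> E" for x
  proof -
    have "x \<in> {-1..1}" using x E by blast
    then obtain z where z: "norm z = 1" "Re z = x" by (rule ex_unit_circle_Re)
    have zz: "z * cnj z = 1" using complex_norm_square[of z] z(1) by simp
    have zs: "z + cnj z = 2 * of_real x" using complex_add_cnj[of z] z(2) by simp
    \<comment> \<open>On the unit circle the reflected summand has the modulus of \<open>Q\<close>
      at the conjugate point, which has the same real part.\<close>
    have bound: "norm (poly P w) \<le> 2 * q" if w: "norm w = 1" "Re w = x" for w
    proof -
      have "w \<noteq> 0" using w by auto
      have "w * cnj w = 1" using complex_norm_square[of w] w(1) by simp
      then have inv: "inverse w = cnj w" using \<open>w \<noteq> 0\<close> by (simp add: field_simps)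
      have "norm (poly P w) \<le> norm (w * poly Q w) + norm (w ^ D * poly Q (cnj w))"
        unfolding P_def using \<open>w \<noteq> 0\<close> Q norm_triangle_ineq
        by (simp add: poly_reflect_poly_nz inv)
      also have "\<dots> = norm (poly Q w) + norm (poly Q (cnj w))"
        using w by (simp add: norm_mult norm_power)
      also have "\<dots> \<le> q + q" using w x by (intro add_mono q) auto
      finally show ?thesis by simp
    qed
    have "poly P z * poly P (cnj z) = (\<Prod>i<Suc D. (z - \<xi> i) * (cnj z - \<xi> i))"
      unfolding P poly_prod by (simp add: prod.distrib)
    also have "\<dots> = (\<Prod>i<Suc D. 2 * (- \<xi> i) * (of_real x - \<eta> i))"
    proof (intro prod.cong refl)
      fix i assume "i \<in> {..<Suc D}"
      then have nz: "\<xi> i \<noteq> 0" using \<xi>0 by auto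
      have "(z - \<xi> i) * (cnj z - \<xi> i) = z * cnj z - \<xi> i * (z + cnj z) + \<xi> i * \<xi> i"
        by (simp add: algebra_simps)
      also have "\<dots> = 1 - \<xi> i * (2 * of_real x) + \<xi> i * \<xi> i" by (simp only: zz zs)
      also have "\<dots> = 2 * (- \<xi> i) * (of_real x - \<eta> i)"
        using nz by (simp add: \<eta>_def field_simps)
      finally show "(z - \<xi> i) * (cnj z - \<xi> i) = 2 * (- \<xi> i) * (of_real x - \<eta> i)" .
    qed
    also have "\<dots> = 2 ^ Suc D * (\<Prod>i<Suc D. of_real x - \<eta> i)"
      using \<xi>1 by (simp only: prod.distrib) simp
    finally have "2 ^ Suc D * (\<Prod>i<Suc D. norm (of_real x - \<eta> i)) = norm (poly P z) * norm (poly P (cnj z))"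
      by (metis norm_mult norm_power norm_numeral prod_norm)
    also have "\<dots> \<le> (2 * q) * (2 * q)"
      using bound[OF z] bound[of "cnj z"] z order.trans[OF norm_ge_zero bound[OF z]]
      by (intro mult_mono) auto
    finally show ?thesis
      by (simp only: power2_eq_square pos_le_divide_eq zero_less_power zero_less_numeral) (simp add: mult_ac)
  qed
  then show ?thesis by (rule that)
qed

section \<open>Handling the minimum deviation, and its limit\<close>

lemma bdd_above_norm_monic:
  fixes S :: "complex set" and c :: "nat \<Rightarrow> complex"
  assumes "compact S"
  shows "bdd_above ((\<lambda>z. norm (z ^ n + (\<Sum>k<n. c k * z ^ k))) ` S)"
  by (intro bounded_imp_bdd_above compact_imp_bounded compact_continuous_image assms continuous_intros)

lemma min_deviation_le:
  fixes p :: "complex poly"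
  assumes S: "compact S" "S \<noteq> {}" and p: "degree p \<le> n" "coeff p n = 1"
    and K: "\<And>z. z \<in> S \<Longrightarrow> norm (poly p z) \<le> K"
  shows "min_deviation n S \<le> K"
proof -
  have deg: "degree p = n" using p le_degree[of p n] by fastforce
  have eq: "poly p z = z ^ n + (\<Sum>k<n. coeff p k * z ^ k)" for z
    using p by (simp add: poly_altdef deg lessThan_Suc_atMost[symmetric] add.commute)
  obtain z0 where z0: "z0 \<in> S" using S by auto
  show ?thesis unfolding min_deviation_def
  proof (rule cINF_lower2)
    show "bdd_below (range (\<lambda>c. SUP z\<in>S. norm (z ^ n + (\<Sum>k<n. c k * z ^ k))))"
    proof (intro bdd_belowI[of _ 0])
      fix t assume "t \<in> range (\<lambda>c. SUP z\<in>S. norm (z ^ n + (\<Sum>k<n. c k * z ^ k)))"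
      then obtain c where t: "t = (SUP z\<in>S. norm (z ^ n + (\<Sum>k<n. c k * z ^ k)))" by auto
      show "0 \<le> t" unfolding t
        by (rule cSUP_upper2[OF bdd_above_norm_monic[OF S(1)] z0]) simp
    qed
    show "(SUP z\<in>S. norm (z ^ n + (\<Sum>k<n. coeff p k * z ^ k))) \<le> K"
      using K S(2) by (intro cSUP_least) (auto simp flip: eq)
  qed simp
qed

text \<open>Stated for an arbitrary bound \<open>q\<close> in place of the supremum, so that its
  applications need no suprema.\<close>

lemma min_deviation_ge:
  assumes S: "compact S"
    and K: "\<And>p q. degree p = n \<Longrightarrow> coeff p n = 1 \<Longrightarrow> (\<And>z. z \<in> S \<Longrightarrow> norm (poly p z) \<le> q) \<Longrightarrow> K \<le> q"
  shows "K \<le> min_deviation n S"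
  unfolding min_deviation_def
proof (rule cINF_greatest)
  fix c :: "nat \<Rightarrow> complex"
  define r where "r = (\<Sum>k<n. monom (c k) k)"
  have r: "coeff r i = (if i < n then c i else 0)" for i
    by (simp add: r_def coeff_sum)
  define p where "p = monom 1 n + r"
  have coeffp: "coeff p n = 1" by (simp add: p_def r)
  have "degree p \<le> n" by (intro degree_le) (simp add: p_def r)
  then have "degree p = n" using coeffp le_degree[of p n] by fastforce
  then show "K \<le> (SUP z\<in>S. norm (z ^ n + (\<Sum>k<n. c k * z ^ k)))"
  proof (rule K)
    fix z assume "z \<in> S"
    have "poly p z = z ^ n + (\<Sum>k<n. c k * z ^ k)"
      by (simp add: p_def r_def poly_monom poly_sum)
    then show "norm (poly p z) \<le> (SUP z\<in>S. norm (z ^ n + (\<Sum>k<n. c k * z ^ k)))"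
      using cSUP_upper[OF \<open>z \<in> S\<close> bdd_above_norm_monic[OF S]] by simp
  qed (fact coeffp)
qed simp

text \<open>After taking logarithms, \<open>ineq\<close> compares every even index with every
  \<open>D\<close>. This confines \<open>ln (L D)\<close> to within a constant of
  \<open>D * A\<close> on both sides: hence the limit \<open>exp A\<close>, and the upper side is
  the claimed bound.\<close>

lemma root_tendsto_and_bound:
  fixes L :: "nat \<Rightarrow> real"
  assumes pos: "\<And>n. 0 < L n" and le1: "\<And>n. L n \<le> 1" and dec: "\<And>n. L (Suc n) \<le> L n" and C: "1 \<le> C"
    and ineq: "\<And>n D. n \<ge> 1 \<Longrightarrow> (L (2 * n) / C) ^ Suc D \<le> 4 ^ n * L D ^ (2 * n)"
  shows "\<exists>B \<kappa>. (\<lambda>n. root n (L n)) \<longlonglongrightarrow> \<kappa> \<and> (\<forall>n\<ge>1. L n \<le> B * \<kappa> ^ n)"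
proof -
  define s where "s n = ln (L n)" for n
  define c where "c = ln C"
  have c: "0 \<le> c" using C by (simp add: c_def)
  have s0: "s n \<le> 0" for n using pos[of n] le1[of n] by (simp add: s_def)
  define a where "a n = (s (2 * n) - c) / (2 * real n)" for n
  have a0: "a n \<le> 0" for n using s0[of "2 * n"] c by (simp add: a_def divide_nonpos_nonneg)
  \<comment> \<open>As a supremum, \<open>A\<close> bounds all \<open>L (2 * n)\<close> from above,
    while \<open>ineq\<close> for fixed \<open>D\<close> bounds it by a quantity in
    \<open>L D\<close>.\<close>
  define A where "A = (SUP n\<in>{1..}. a n)"
  have bdd: "bdd_above (a ` {1..})" using a0 by (intro bdd_aboveI[of _ 0]) auto
  have aA: "a n \<le> A" if "n \<ge> 1" for n
    unfolding A_def using that bdd by (intro cSUP_upper) auto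
  have A0: "A \<le> 0" unfolding A_def using a0 by (intro cSUP_least) auto
  have lower: "real (Suc D) * A - ln 2 \<le> s D" for D
  proof -
    have "A \<le> (ln 2 + s D) / real (Suc D)"
      unfolding A_def
    proof (rule cSUP_least)
      fix n :: nat assume "n \<in> {1..}"
      then have n: "n \<ge> 1" by simp
      have "ln ((L (2 * n) / C) ^ Suc D) \<le> ln (4 ^ n * L D ^ (2 * n))"
        using ineq[OF n, of D] pos C by (subst ln_le_cancel_iff) (auto intro!: mult_pos_pos zero_less_power divide_pos_pos)
      also have "ln ((L (2 * n) / C) ^ Suc D) = real (Suc D) * (s (2 * n) - c)"
        using pos[of "2 * n"] C by (simp only: ln_realpow ln_div s_def c_def) (simp add: ln_div)
      also have "ln (4 ^ n * L D ^ (2 * n)) = real n * ln 4 + 2 * real n * s D"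
        using pos[of D] by (simp add: ln_mult ln_realpow s_def)
      also have "ln (4::real) = 2 * ln 2" using ln_realpow[of 2 2] by simp
      finally show "a n \<le> (ln 2 + s D) / real (Suc D)"
        using n by (simp add: a_def field_simps)
    qed simp
    then show ?thesis by (simp add: pos_le_divide_eq algebra_simps)
  qed
  have upper_even: "s (2 * n) \<le> 2 * real n * A + c" if "n \<ge> 1" for n
    using aA[OF that] that by (simp add: a_def field_simps)
  \<comment> \<open>Odd \<open>D\<close> are reduced to \<open>D - 1\<close> by monotonicity; the
    missing \<open>A\<close>, which is not positive, goes into the constant.\<close>
  have upper: "s D \<le> real D * A + (c - A)" for D
  proof (cases "D < 2")
    case True
    then have "D = 0 \<or> D = 1" by auto
    then show ?thesis using s0[of D] c A0 by auto
  next
    case False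
    define n where "n = D div 2"
    have n: "n \<ge> 1" and D: "D = 2 * n \<or> D = Suc (2 * n)" using False by (auto simp: n_def)
    have "s D \<le> s (2 * n)" using D dec[of "2 * n"] pos by (auto simp: s_def)
    also have "\<dots> \<le> 2 * real n * A + c" using upper_even[OF n] .
    also have "\<dots> \<le> real D * A + (c - A)" using D A0 by (auto simp: algebra_simps)
    finally show ?thesis .
  qed
  have "(\<lambda>n. s n / real n) \<longlonglongrightarrow> A"
  proof (rule tendsto_sandwich)
    show "\<forall>\<^sub>F n in sequentially. A + (A - ln 2) / real n \<le> s n / real n"
      using eventually_gt_at_top[of 0]
    proof eventually_elim
      case (elim n)
      have "A + (A - ln 2) / real n = (real (Suc n) * A - ln 2) / real n"
        using elim by (simp add: add_divide_distrib diff_divide_distrib algebra_simps)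
      also have "\<dots> \<le> s n / real n" by (intro divide_right_mono lower) simp
      finally show ?case .
    qed
    show "\<forall>\<^sub>F n in sequentially. s n / real n \<le> A + (c - A) / real n"
      using eventually_gt_at_top[of 0]
    proof eventually_elim
      case (elim n)
      have "s n / real n \<le> (real n * A + (c - A)) / real n" by (intro divide_right_mono upper) simp
      also have "\<dots> = A + (c - A) / real n" using elim by (simp add: add_divide_distrib)
      finally show ?case .
    qed
    have "(\<lambda>n. A + x / real n) \<longlonglongrightarrow> A + 0" for x
      by (intro tendsto_intros lim_const_over_n)
    then show "(\<lambda>n. A + (A - ln 2) / real n) \<longlonglongrightarrow> A" "(\<lambda>n. A + (c - A) / real n) \<longlonglongrightarrow> A"
      by simp_all
  qed
  then have "(\<lambda>n. exp (s n / real n)) \<longlonglongrightarrow> exp A" by (rule tendsto_exp)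
  moreover have "\<forall>\<^sub>F n in sequentially. exp (s n / real n) = root n (L n)"
    using eventually_gt_at_top[of 0]
  proof eventually_elim
    case (elim n)
    then show ?case using pos[of n] by (simp add: root_powr_inverse powr_def s_def)
  qed
  ultimately have "(\<lambda>n. root n (L n)) \<longlonglongrightarrow> exp A" by (rule Lim_transform_eventually)
  moreover have "L n \<le> exp (c - A) * exp A ^ n" for n
  proof -
    have "L n = exp (s n)" using pos[of n] by (simp add: s_def)
    also have "\<dots> \<le> exp (real n * A + (c - A))" using upper[of n] by simp
    also have "\<dots> = exp (c - A) * exp A ^ n" by (simp add: exp_add exp_of_nat_mult)
    finally show ?thesis .
  qed
  ultimately show ?thesis by blast
qed

text \<open>On the unit circle \<open>z * z - 2 * r * z + 1 = 2 * z * (Re z - r)\<close>, so the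
  product of these quadratics over \<open>Z\<close> is a suitable competitor.\<close>

lemma min_deviation_unit_circle_le:
  fixes E :: "real set"
  assumes S: "compact S" "S \<noteq> {}" "\<And>z. z \<in> S \<Longrightarrow> norm z = 1 \<and> Re z \<in> E"
    and Z: "finite Z" "card Z = n" and K: "\<And>x. x \<in> E \<Longrightarrow> \<bar>\<Prod>r\<in>Z. x - r\<bar> \<le> K"
  shows "min_deviation (2 * n) S \<le> 2 ^ n * K"
proof -
  define p where "p = (\<Prod>r\<in>Z. [:1, - 2 * complex_of_real r, 1:])"
  have deg: "degree p = 2 * n"
    unfolding p_def using Z by (subst degree_prod_sum_eq) auto
  have lead: "coeff p (2 * n) = 1"
    using lead_coeff_prod[of "\<lambda>r. [:1, - 2 * complex_of_real r, 1:]" Z] deg by (simp add: p_def)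
  have "norm (poly p z) \<le> 2 ^ n * K" if z: "z \<in> S" for z
  proof -
    have z1: "norm z = 1" "Re z \<in> E" using S(3)[OF z] by auto
    have zz: "z * cnj z = 1" using complex_norm_square[of z] z1(1) by simp
    have zs: "z + cnj z = 2 * of_real (Re z)" using complex_add_cnj[of z] by simp
    have "norm (poly [:1, - 2 * complex_of_real r, 1:] z) = 2 * \<bar>Re z - r\<bar>" for r
    proof -
      have "poly [:1, - 2 * complex_of_real r, 1:] z = z * cnj z - 2 * of_real r * z + z * z"
        unfolding zz by (simp add: algebra_simps)
      also have "\<dots> = z * ((z + cnj z) - 2 * of_real r)" by (simp add: algebra_simps)
      also have "\<dots> = z * of_real (2 * (Re z - r))" unfolding zs by simp
      also have "norm \<dots> = 2 * \<bar>Re z - r\<bar>"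
        unfolding norm_mult norm_of_real z1(1) by (simp only: abs_mult abs_numeral mult_1_left)
      finally show ?thesis .
    qed
    then have "norm (poly p z) = (\<Prod>r\<in>Z. 2 * \<bar>Re z - r\<bar>)"
      unfolding p_def poly_prod prod_norm[symmetric] by (intro prod.cong) auto
    also have "\<dots> = 2 ^ n * \<bar>\<Prod>r\<in>Z. Re z - r\<bar>"
      using Z(2) by (simp add: prod.distrib abs_prod)
    also have "\<dots> \<le> 2 ^ n * K" by (intro mult_left_mono K z1) simp
    finally show ?thesis .
  qed
  then show ?thesis using S deg lead by (intro min_deviation_le) auto
qed

lemma min_deviation_le_one:
  assumes "compact S" "S \<noteq> {}" "\<And>z. z \<in> S \<Longrightarrow> norm z = 1"
  shows "min_deviation n S \<le> 1"
  using assms by (intro min_deviation_le[of _ "monom 1 n"]) (auto simp: degree_monom_eq poly_monom norm_power)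

lemma min_deviation_Suc_le:
  assumes "compact S" "S \<noteq> {}" "\<And>z. z \<in> S \<Longrightarrow> norm z = 1"
  shows "min_deviation (Suc n) S \<le> min_deviation n S"
proof (rule min_deviation_ge[OF assms(1)])
  fix p q assume p: "degree p = n" "coeff p n = 1" "\<And>z. z \<in> S \<Longrightarrow> norm (poly p z) \<le> q"
  show "min_deviation (Suc n) S \<le> q"
    by (rule min_deviation_le[of _ "pCons 0 p"]) (use assms p in \<open>auto simp: norm_mult\<close>)
qed

lemma min_deviation_nonneg:
  assumes "compact S" "S \<noteq> {}"
  shows "0 \<le> min_deviation n S"
proof (rule min_deviation_ge[OF assms(1)])
  fix p and q :: real assume "\<And>z. z \<in> S \<Longrightarrow> norm (poly p z) \<le> q"
  then show "0 \<le> q" using assms(2) norm_ge_zero order.trans by blast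
qed

section \<open>Comparing degrees and deducing the capacity bound\<close>

text \<open>The deviation \<open>d\<close> on \<open>E\<close> mediates: it bounds degree
  \<open>2 * n\<close> from above and, being independent of \<open>D\<close>, every degree
  \<open>D\<close> from below.\<close>

lemma min_deviation_circle_bound:
  fixes E :: "real set" and S :: "complex set"
  assumes E: "compact E" "E \<subseteq> {-1..1}" "{u..v} \<subseteq> E" "u < v"
    and sep: "separated_outside_le E G"
    and S: "compact S" "S = {z. norm z = 1 \<and> Re z \<in> E}"
    and c: "c = 4 * exp 1 * (8 * exp 1 / (v - u)) ^ G"
    and n: "n \<ge> 1" and e: "0 < e"
  obtains d where "0 < d" "min_deviation (2 * n) S \<le> 2 ^ n * (d + e)"
    "\<And>D. (2 ^ n * d / c) ^ Suc D \<le> 4 ^ n * min_deviation D S ^ (2 * n)"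
proof -
  have c0: "0 < c" using E by (simp add: c)
  have "u \<in> E" using E(3,4) by auto
  then have "u \<in> {-1..1}" using E(2) by blast
  then obtain z where "norm z = 1" "Re z = u" using ex_unit_circle_Re by blast
  then have "S \<noteq> {}" using \<open>u \<in> E\<close> by (auto simp: S(2))
  have "infinite E" using E(3,4) infinite_Icc infinite_super by blast
  obtain X T d Z where XT: "X \<subseteq> E" "card X = Suc n" "0 < d" "degree T \<le> n" "coeff T n = 1"
    "\<And>x. x \<in> X \<Longrightarrow> poly T x = d * sgn (node_prod X x)" "\<And>x. x \<in> E \<Longrightarrow> \<bar>poly T x\<bar> \<le> d + e"
    "finite Z" "card Z = n" "T = (\<Prod>z\<in>Z. [:- z, 1:])"
    by (rule ex_alternating_poly[OF E(1) \<open>infinite E\<close> E(2) n e]) (rule that)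
  have "min_deviation (2 * n) S \<le> 2 ^ n * (d + e)"
  proof (rule min_deviation_unit_circle_le[OF S(1) \<open>S \<noteq> {}\<close> _ XT(8,9)])
    show "\<bar>\<Prod>r\<in>Z. x - r\<bar> \<le> d + e" if "x \<in> E" for x
      using XT(7)[OF that] by (simp add: XT(10) poly_prod)
  qed (simp add: S(2))
  moreover have "(2 ^ n * d / c) ^ Suc D \<le> 4 ^ n * min_deviation D S ^ (2 * n)" for D
  proof -
    define W where "W = (2 ^ n * d / c) ^ Suc D"
    \<comment> \<open>The goal reads \<open>V \<le> min_deviation D S ^ (2 * n)\<close>. The root of
      \<open>V\<close> is a lower bound for \<open>q\<close> itself, the form needed by
      \<open>min_deviation_ge\<close>.\<close>
    define V where "V = W / 4 ^ n"
    have V0: "0 \<le> V" using XT(3) c0 by (simp add: V_def W_def)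
    have "root (2 * n) V \<le> min_deviation D S"
    proof (rule min_deviation_ge[OF S(1)])
      fix Q q assume Q: "degree Q = D" "coeff Q D = 1" "\<And>z. z \<in> S \<Longrightarrow> norm (poly Q z) \<le> q"
      have q0: "0 \<le> q" using Q(3) \<open>S \<noteq> {}\<close> norm_ge_zero order.trans by blast
      obtain \<eta> where \<eta>: "\<And>x. x \<in> E \<Longrightarrow> (\<Prod>i<Suc D. norm (complex_of_real x - \<eta> i)) \<le> 4 * q\<^sup>2 / 2 ^ Suc D"
        by (rule unit_circle_le_imp_interval_le[OF E(2) Q(1,2), of q]) (use Q(3) S(2) in auto)
      have "d ^ Suc D \<le> (4 * q\<^sup>2 / 2 ^ Suc D) ^ n * c ^ Suc D"
        unfolding c
        using alternation_le_sup[OF E(2-4) sep XT(1,2) n XT(4,5,3,6,10) \<eta>] by blast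
      then have "d ^ Suc D / c ^ Suc D \<le> (4 * q\<^sup>2 / 2 ^ Suc D) ^ n"
        using pos_divide_le_eq[of "c ^ Suc D"] c0 zero_less_power by blast
      then have "(2 ^ n) ^ Suc D * (d ^ Suc D / c ^ Suc D) \<le> (2 ^ n) ^ Suc D * (4 * q\<^sup>2 / 2 ^ Suc D) ^ n"
        by (rule mult_left_mono) simp
      then have "(2 ^ n * d / c) ^ Suc D \<le> (2 ^ n) ^ Suc D * (4 * q\<^sup>2 / 2 ^ Suc D) ^ n"
        by (simp only: power_divide power_mult_distrib times_divide_eq_right)
      also have "\<dots> = (2 ^ Suc D * (4 * q\<^sup>2 / 2 ^ Suc D)) ^ n"
        by (simp only: power_mult_distrib flip: power_mult) (simp add: mult.commute)
      also have "\<dots> = 4 ^ n * q ^ (2 * n)"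
        by (simp add: power_mult_distrib power_mult)
      finally have "V \<le> q ^ (2 * n)" unfolding W_def[symmetric] by (simp add: V_def field_simps)
      then have "root (2 * n) V \<le> root (2 * n) (q ^ (2 * n))" using n by simp
      also have "\<dots> = q" using n q0 by (intro real_root_power_cancel) auto
      finally show "root (2 * n) V \<le> q" .
    qed
    then have "root (2 * n) V ^ (2 * n) \<le> min_deviation D S ^ (2 * n)"
      using V0 by (intro power_mono real_root_ge_zero)
    then have "V \<le> min_deviation D S ^ (2 * n)"
      using n V0 real_root_pow_pos2[of "2 * n" V] by simp
    then show ?thesis unfolding W_def[symmetric] by (simp add: V_def field_simps)
  qed
  ultimately show ?thesis using that XT(3) by blast
qed

lemma min_deviation_circle_le_capacity:
  fixes E :: "real set" and S :: "complex set"
  assumes E: "compact E" "E \<subseteq> {-1..1}" "{u..v} \<subseteq> E" "u < v"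
    and sep: "separated_outside_le E G"
    and S: "S = {z. norm z = 1 \<and> Re z \<in> E}"
  shows "\<exists>B. \<forall>n\<ge>1. min_deviation n S \<le> B * log_capacity S ^ n"
proof -
  define c where "c = 4 * exp 1 * (8 * exp 1 / (v - u)) ^ G"
  define L where "L n = min_deviation n S" for n
  have "u \<in> E" "v \<in> E" using E(3,4) by auto
  then have uv: "u \<in> {-1..1}" "v \<in> {-1..1}" using E(2) by blast+
  have "1 \<le> (8 * exp 1 / (v - u)) ^ G"
    using one_le_exp_div_length[OF uv E(4)] by (rule one_le_power)
  moreover have "1 \<le> 4 * exp (1::real)"
    using one_le_exp_iff[of "1::real"] by linarith
  ultimately have c1: "1 \<le> c" unfolding c_def using mult_mono[of 1 "4 * exp 1" 1] by fastforce
  have S_eq: "S = sphere 0 1 \<inter> Re -` E" by (auto simp: S)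
  have cS: "compact S" unfolding S_eq
    by (intro compact_Int_closed continuous_closed_vimage compact_imp_closed E continuous_intros) auto
  obtain z where "norm z = 1" "Re z = u" using ex_unit_circle_Re uv(1) by blast
  then have "S \<noteq> {}" using \<open>u \<in> E\<close> by (auto simp: S)
  have S1: "norm z = 1" if "z \<in> S" for z using that by (simp add: S)
  note bound = min_deviation_circle_bound[OF E sep cS S c_def]
  have L0: "0 \<le> L n" for n unfolding L_def by (rule min_deviation_nonneg[OF cS \<open>S \<noteq> {}\<close>])
  \<comment> \<open>Positivity is needed for logarithms; the bound for \<open>n = 1\<close>, with
    any positive error, supplies it.\<close>
  have pos: "0 < L D" for D
  proof -
    obtain d where d: "0 < d" "min_deviation (2 * 1) S \<le> 2 ^ 1 * (d + 1)"
      "\<And>D. (2 ^ 1 * d / c) ^ Suc D \<le> 4 ^ 1 * min_deviation D S ^ (2 * 1)"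
      by (rule bound[OF order.refl zero_less_one]) (rule that)
    have "0 < (2 ^ 1 * d / c) ^ Suc D" using d(1) c1 by (intro zero_less_power divide_pos_pos) auto
    also note d(3)[of D]
    finally have "L D \<noteq> 0" by (auto simp: L_def)
    then show ?thesis using L0[of D] by simp
  qed
  have "\<exists>B \<kappa>. (\<lambda>n. root n (L n)) \<longlonglongrightarrow> \<kappa> \<and> (\<forall>n\<ge>1. L n \<le> B * \<kappa> ^ n)"
  proof (rule root_tendsto_and_bound)
    show "0 < L n" for n by (rule pos)
    show "L n \<le> 1" for n unfolding L_def by (rule min_deviation_le_one[OF cS \<open>S \<noteq> {}\<close> S1])
    show "L (Suc n) \<le> L n" for n unfolding L_def by (rule min_deviation_Suc_le[OF cS \<open>S \<noteq> {}\<close> S1])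
    show "1 \<le> 2 * c" using c1 by simp
    fix n D :: nat assume n: "n \<ge> 1"
    \<comment> \<open>With this error \<open>2 ^ n * e\<close> is half of \<open>L (2 * n)\<close>,
      so it is absorbed at the price of the factor 2 in \<open>2 * c\<close>.\<close>
    define e where "e = L (2 * n) / 2 / 2 ^ n"
    have "0 < e" using pos by (simp add: e_def)
    obtain d where d: "0 < d" "min_deviation (2 * n) S \<le> 2 ^ n * (d + e)"
      "\<And>D. (2 ^ n * d / c) ^ Suc D \<le> 4 ^ n * min_deviation D S ^ (2 * n)"
      by (rule bound[OF n \<open>0 < e\<close>]) (rule that)
    have "2 ^ n * e = L (2 * n) / 2" by (simp add: e_def)
    then have "L (2 * n) / 2 \<le> 2 ^ n * d" using d(2) by (simp add: distrib_left L_def)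
    then have "L (2 * n) / (2 * c) \<le> 2 ^ n * d / c"
      using c1 by (simp add: field_simps)
    then have "(L (2 * n) / (2 * c)) ^ Suc D \<le> (2 ^ n * d / c) ^ Suc D"
      using L0 c1 by (intro power_mono divide_nonneg_nonneg) auto
    then show "(L (2 * n) / (2 * c)) ^ Suc D \<le> 4 ^ n * L D ^ (2 * n)" using d(3)[of D] unfolding L_def by (rule order.trans)
  qed
  then obtain B \<kappa> where lim: "(\<lambda>n. root n (L n)) \<longlonglongrightarrow> \<kappa>" and B: "\<forall>n\<ge>1. L n \<le> B * \<kappa> ^ n" by blast
  \<comment> \<open>Convergence is now proved, so \<open>lim\<close> denotes the actual
    limit.\<close>
  have "log_capacity S = \<kappa>" using lim limI by (simp add: log_capacity_def L_def)
  then show ?thesis using B by (auto simp: L_def)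
qed

section \<open>Finite unions of intervals\<close>

lemma separated_outside_le_Union_intervals:
  fixes b c :: "nat \<Rightarrow> real"
  assumes "finite J" "E = (\<Union>j\<in>J. {b j..c j})"
  shows "separated_outside_le E (Suc (card J))"
  unfolding separated_outside_le_def
proof (intro allI impI)
  fix Y assume "finite Y" and sep: "\<forall>r\<in>Y. \<forall>r'\<in>Y. r < r' \<longrightarrow> (\<exists>x\<in>E. r < x \<and> x < r')"
  \<comment> \<open>Points of \<open>Y - E\<close> are told apart by the number of left endpoints to their right.\<close>
  define \<phi> where "\<phi> r = card {j \<in> J. r < b j}" for r
  have less: "\<phi> r' < \<phi> r" if r: "r \<in> Y - E" "r' \<in> Y - E" "r < r'" for r r'
  proof -
    obtain x where x: "x \<in> E" "r < x" "x < r'" using sep r by blast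
    then obtain j where j: "j \<in> J" "b j \<le> x" "x \<le> c j" using assms(2) by auto
    \<comment> \<open>Since \<open>r\<close> is outside \<open>E\<close> and left of a point of the
      interval, it is left of its left endpoint \<open>b j\<close>, which therefore lies between
      \<open>r\<close> and \<open>r'\<close>.\<close>
    have "r < b j" using r(1) x j assms(2) by force
    then have "{j \<in> J. r' < b j} \<subset> {j \<in> J. r < b j}" using j x r(3) by force
    then show ?thesis unfolding \<phi>_def using assms(1) by (intro psubset_card_mono) auto
  qed
  then have "inj_on \<phi> (Y - E)" by (intro linorder_inj_onI') force
  moreover have "\<phi> ` (Y - E) \<subseteq> {..card J}"
    using assms(1) by (auto simp: \<phi>_def intro!: card_mono)
  ultimately have "card (Y - E) \<le> card {..card J}" by (intro card_inj_on_le) auto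
  then show "card (Y - E) \<le> Suc (card J)" by simp
qed

theorem theorem7:
  fixes l :: nat and a :: "nat \<Rightarrow> real" and E :: "real set" and \<Lambda> :: "complex set"
  assumes "l \<ge> 2"
    and "a (2 * l) = -1" and "a 1 = 1"
    and "\<And>j. 1 \<le> j \<Longrightarrow> j < 2 * l \<Longrightarrow> a (j + 1) < a j"
    and "E = (\<Union>j\<in>{1..l}. {a (2 * j)..a (2 * j - 1)})"
    and "\<Lambda> = {z :: complex. norm z = 1 \<and> Re z \<in> E}"
  shows "\<exists>B :: real. \<forall>n :: nat. n \<ge> 1 \<longrightarrow> min_deviation n \<Lambda> \<le> B * log_capacity \<Lambda> ^ n"
proof (rule min_deviation_circle_le_capacity[OF _ _ _ _ _ assms(6)])
  have dec: "a j \<le> a i" if "1 \<le> i" "i \<le> j" "j \<le> 2 * l" for i j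
    using that(2,3)
  proof (induction j rule: dec_induct)
    case (step k)
    then show ?case using assms(4)[of k] that(1) by simp
  qed simp
  show "compact E" unfolding assms(5) by (intro compact_UN) auto
  show "E \<subseteq> {-1..1}"
  proof
    fix x assume "x \<in> E"
    then obtain j where j: "j \<in> {1..l}" "a (2 * j) \<le> x" "x \<le> a (2 * j - 1)" using assms(5) by auto
    have "1 \<le> 2 * j - 1" "2 * j - 1 \<le> 2 * l" "1 \<le> 2 * j" "2 * j \<le> 2 * l" using j(1) by auto
    then have "a (2 * l) \<le> a (2 * j)" "a (2 * j - 1) \<le> a 1" by (auto intro!: dec)
    then show "x \<in> {-1..1}" using j(2,3) assms(2,3) by auto
  qed
  \<comment> \<open>The rightmost component serves as the interval of positive length on which the
    constants depend.\<close>
  show "{a 2..a 1} \<subseteq> E" unfolding assms(5) using assms(1) by (force intro!: bexI[of _ 1])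
  show "a 2 < a 1" using assms(4)[of 1] assms(1) by (simp add: numeral_2_eq_2)
  show "separated_outside_le E (Suc (card {1..l}))"
    by (rule separated_outside_le_Union_intervals[OF _ assms(5)]) simp
qed

end
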